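(* Algorithm I (described in the context) is an $O(\log k)$-competitive online algorithm for covering linear programs without upper-bound constraints. Precisely: there is an absolute constant $C$ such that for every instance (costs $c_i>0$, coefficients $a_{ij}\ge 0$, every arriving row having at least one positive entry), the vector $x$ maintained by Algorithm I is coordinatewise non-decreasing over time, and after constraints $1,\dots,m$ have been processed it satisfies $\sum_i a_{ij}x_i\ge 1$ for all $j\le m$, $x\ge 0$, and $$\sum_{i=1}^n c_i x_i \le C\log k\cdot \mathrm{OPT}_m,$$ where $\mathrm{OPT}_m=\min\{\sum_i c_ix_i : \sum_i a_{ij}x_i\ge 1\ \forall j\le m,\ x\ge 0\}$ and $k$ is the row-sparsity of the constraint matrix (with $k$ replaced by $\max\{k,2\}$).
   Context: Online covering LP without upper bounds: there are $n$ variables $x_1,\dots,x_n\ge 0$ with costs $c_i>0$; constraints $\sum_{i=1}^n a_{ij}x_i\ge 1$ with $a_{ij}\ge 0$ arrive one at a time ($j=1,2,\dots$). Let $T_j=\{i: a_{ij}>0\}$, assumed nonempty. The row-sparsity is $\max_j |T_j|$. An online algorithm must, after the arrival of each constraint, hold a vector $x\ge 0$ satisfying all constraints that have arrived so far, and may only increase coordinates of $x$ over time. $\log$ denotes $\log_2$. Algorithm I: start with $x=0$. When constraint $h$ arrives, set $k$ to the smallest power of $2$ that is at least $\max\{2,|T_1|,\dots,|T_h|\}$. Define $d_{ih}=c_i/a_{ih}$ for $i\in T_h$ and $d_{m(h)}=\min_{i\in T_h} d_{ih}$. While $\sum_i a_{ih}x_i<1$, replace simultaneously for every $i\in T_h$: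 $$x_i\leftarrow \Big(1+\frac{d_{m(h)}}{d_{ih}}\Big)x_i+\frac{1}{k\,a_{ih}}\cdot\frac{d_{m(h)}}{d_{ih}}.$$ *)

theory Defs
  imports "HOL-Analysis.Analysis" "HOL-Library.While_Combinator"
begin

text \<open>
  An instance has variables \<open>1..n\<close>, costs \<open>c i\<close> and rows \<open>j = 1, 2, \<dots>\<close> with coefficients
  \<open>a i j\<close>. The dimension is a number and not a type, so that one constant can serve all \<open>n\<close>.
  A vector is a function \<open>nat \<Rightarrow> real\<close>, of which only the values on \<open>1..n\<close> matter.
\<close>

definition cost :: "nat \<Rightarrow> (nat \<Rightarrow> real) \<Rightarrow> (nat \<Rightarrow> real) \<Rightarrow> real" where
  "cost n c x = (\<Sum>i=1..n. c i * x i)"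

definition lhs :: "nat \<Rightarrow> (nat \<Rightarrow> nat \<Rightarrow> real) \<Rightarrow> nat \<Rightarrow> (nat \<Rightarrow> real) \<Rightarrow> real" where
  "lhs n a j x = (\<Sum>i=1..n. a i j * x i)"

definition feasible :: "nat \<Rightarrow> (nat \<Rightarrow> nat \<Rightarrow> real) \<Rightarrow> nat \<Rightarrow> (nat \<Rightarrow> real) \<Rightarrow> bool" where
  "feasible n a m x \<longleftrightarrow> (\<forall>i\<in>{1..n}. 0 \<le> x i) \<and> (\<forall>j\<in>{1..m}. 1 \<le> lhs n a j x)"

definition supp :: "nat \<Rightarrow> (nat \<Rightarrow> nat \<Rightarrow> real) \<Rightarrow> nat \<Rightarrow> nat set" where
  "supp n a j = {i \<in> {1..n}. 0 < a i j}"

definition covering_instance ::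
  "nat \<Rightarrow> (nat \<Rightarrow> real) \<Rightarrow> (nat \<Rightarrow> nat \<Rightarrow> real) \<Rightarrow> nat \<Rightarrow> bool" where
  "covering_instance n c a m \<longleftrightarrow>
     (\<forall>i\<in>{1..n}. 0 < c i) \<and>
     (\<forall>i\<in>{1..n}. \<forall>j\<in>{1..m}. 0 \<le> a i j) \<and>
     (\<forall>j\<in>{1..m}. supp n a j \<noteq> {})"

definition row_sparsity :: "nat \<Rightarrow> (nat \<Rightarrow> nat \<Rightarrow> real) \<Rightarrow> nat \<Rightarrow> nat" where
  "row_sparsity n a m = Max (insert 0 ((\<lambda>j. card (supp n a j)) ` {1..m}))"

text \<open>\<open>LEAST\<close> is the minimum of the set of feasible costs; it exists by \<open>OPT_attained\<close> below.\<close>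

definition OPT :: "nat \<Rightarrow> (nat \<Rightarrow> real) \<Rightarrow> (nat \<Rightarrow> nat \<Rightarrow> real) \<Rightarrow> nat \<Rightarrow> real" where
  "OPT n c a m = (LEAST v. \<exists>x. feasible n a m x \<and> v = cost n c x)"

definition kpow :: "nat \<Rightarrow> (nat \<Rightarrow> nat \<Rightarrow> real) \<Rightarrow> nat \<Rightarrow> nat" where
  "kpow n a h = (LEAST p. (\<exists>e. p = 2 ^ e) \<and> max 2 (row_sparsity n a h) \<le> p)"

definition d :: "(nat \<Rightarrow> real) \<Rightarrow> (nat \<Rightarrow> nat \<Rightarrow> real) \<Rightarrow> nat \<Rightarrow> nat \<Rightarrow> real" where
  "d c a i h = c i / a i h"

definition dmin :: "nat \<Rightarrow> (nat \<Rightarrow> real) \<Rightarrow> (nat \<Rightarrow> nat \<Rightarrow> real) \<Rightarrow> nat \<Rightarrow> real" where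
  "dmin n c a h = Min ((\<lambda>i. d c a i h) ` supp n a h)"

definition update ::
  "nat \<Rightarrow> (nat \<Rightarrow> real) \<Rightarrow> (nat \<Rightarrow> nat \<Rightarrow> real) \<Rightarrow> nat \<Rightarrow> (nat \<Rightarrow> real) \<Rightarrow> (nat \<Rightarrow> real)" where
  "update n c a h x = (\<lambda>i.
     if i \<in> supp n a h
     then (1 + dmin n c a h / d c a i h) * x i
            + 1 / (real (kpow n a h) * a i h) * (dmin n c a h / d c a i h)
     else x i)"

text \<open>
  The run is recorded as the list of all vectors held so far, oldest first, one entry per
  update; the current vector is the last one. The earlier entries only serve to state
  monotonicity over time. \<open>None\<close> means that some while loop does not terminate. The value at
  \<open>h\<close> uses only rows \<open>1..h\<close>, so the algorithm is online.
\<close>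

primrec algI ::
  "nat \<Rightarrow> (nat \<Rightarrow> real) \<Rightarrow> (nat \<Rightarrow> nat \<Rightarrow> real) \<Rightarrow> nat \<Rightarrow> (nat \<Rightarrow> real) list option" where
  "algI n c a 0 = Some [\<lambda>_. 0]"
| "algI n c a (Suc h) =
     Option.bind (algI n c a h)
       (while_option (\<lambda>xs. lhs n a (Suc h) (last xs) < 1)
                     (\<lambda>xs. xs @ [update n c a (Suc h) (last xs)]))"

lemma feasible_exists:
  assumes "covering_instance n c a m"
  shows "\<exists>x. feasible n a m x"
proof -
  define g where "g i j = (if 0 < a i j then 1 / a i j else 0)" for i j
  define x where "x i = (\<Sum>j=1..m. g i j)" for i
  have g0: "0 \<le> g i j" for i j by (simp add: g_def)
  have x0: "0 \<le> x i" for i by (simp add: x_def g0 sum_nonneg)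
  have "1 \<le> lhs n a j x" if j: "j \<in> {1..m}" for j
  proof -
    have "supp n a j \<noteq> {}" using assms j by (simp add: covering_instance_def)
    then obtain i where i: "i \<in> {1..n}" "0 < a i j" by (auto simp: supp_def)
    have "g i j \<le> x i"
      unfolding x_def using j g0 by (intro member_le_sum) auto
    hence "a i j * g i j \<le> a i j * x i" using i by simp
    hence "1 \<le> a i j * x i" using i by (simp add: g_def)
    also have "\<dots> \<le> lhs n a j x"
      unfolding lhs_def using assms i j x0
      by (intro member_le_sum[of i _ "\<lambda>i. a i j * x i"]) (auto simp: covering_instance_def)
    finally show ?thesis .
  qed
  thus ?thesis using x0 by (intro exI[of _ x]) (auto simp: feasible_def)
qed

lemma continuous_on_weighted_sum:
  "continuous_on S (\<lambda>x::nat \<Rightarrow> real. \<Sum>i=1..n. w i * x i)"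
  by (intro continuous_intros continuous_on_subset[OF continuous_on_product_coordinates]) auto

lemma OPT_attained:
  assumes inst: "covering_instance n c a m"
  shows "\<exists>x. feasible n a m x \<and> cost n c x = OPT n c a m"
    and "feasible n a m y \<Longrightarrow> OPT n c a m \<le> cost n c y"
proof -
  obtain x0 where x0: "feasible n a m x0" using feasible_exists[OF inst] by blast
  have cpos: "0 < c i" if "i \<in> {1..n}" for i using inst that by (auto simp: covering_instance_def)
  define r where "r x = (\<lambda>i. if i \<in> {1..n} then x i else (0::real))" for x :: "nat \<Rightarrow> real"
  have "lhs n a j (r x) = lhs n a j x" for j x
    unfolding lhs_def by (rule sum.cong) (auto simp: r_def)
  moreover have "0 \<le> r x i \<longleftrightarrow> 0 \<le> x i" if "i \<in> {1..n}" for i x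
    using that by (simp add: r_def)
  ultimately have rf: "feasible n a m (r x) = feasible n a m x" for x
    by (simp add: feasible_def)
  have rc: "cost n c (r x) = cost n c x" for x
    unfolding cost_def by (rule sum.cong) (auto simp: r_def)
  note r = rf rc
  define B where "B i = (if i \<in> {1..n} then {0..cost n c x0 / c i} else {0::real})" for i
  have "compactin (product_topology (\<lambda>_. euclidean) UNIV) (PiE UNIV B)"
    by (subst compactin_PiE) (auto simp: B_def)
  hence "compact (PiE UNIV B)" by (simp add: euclidean_product_topology)
  moreover have "closed {x. feasible n a m x}"
  proof -
    have 1: "closed {x::nat \<Rightarrow> real. 0 \<le> x i}" for i
      by (intro closed_Collect_le continuous_on_product_coordinates continuous_intros)
    have 2: "closed {x. 1 \<le> lhs n a j x}" for j
      unfolding lhs_def by (intro closed_Collect_le continuous_on_weighted_sum continuous_intros)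
    have "{x. feasible n a m x} = (\<Inter>i\<in>{1..n}. {x. 0 \<le> x i}) \<inter> (\<Inter>j\<in>{1..m}. {x. 1 \<le> lhs n a j x})"
      by (auto simp: feasible_def)
    thus ?thesis using 1 2 by (metis (no_types, lifting) closed_INT closed_Int)
  qed
  ultimately have comp: "compact (PiE UNIV B \<inter> {x. feasible n a m x})" by blast
  have inB: "r x \<in> PiE UNIV B" if "feasible n a m x" "cost n c x \<le> cost n c x0" for x
  proof -
    have "x i \<le> cost n c x0 / c i" if i: "i \<in> {1..n}" for i
    proof -
      have "c i * x i \<le> cost n c x"
        unfolding cost_def using i \<open>feasible n a m x\<close> cpos
        by (intro member_le_sum[of i _ "\<lambda>i. c i * x i"]) (auto simp: feasible_def less_imp_le)
      thus ?thesis using \<open>cost n c x \<le> cost n c x0\<close> cpos[OF i] by (simp add: field_simps)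
    qed
    thus ?thesis using \<open>feasible n a m x\<close> by (auto simp: r_def B_def feasible_def)
  qed
  let ?K = "PiE UNIV B \<inter> {x. feasible n a m x}"
  have cont: "continuous_on ?K (cost n c)"
    unfolding cost_def[abs_def] by (rule continuous_on_weighted_sum)
  have "r x0 \<in> ?K" using inB[OF x0] x0 r(1) by auto
  hence "?K \<noteq> {}" by blast
  from continuous_attains_inf[OF comp this cont]
  obtain z where z: "feasible n a m z"
    and zmin: "\<And>y. y \<in> PiE UNIV B \<Longrightarrow> feasible n a m y \<Longrightarrow> cost n c z \<le> cost n c y"
    by blast
  have min: "cost n c z \<le> cost n c y" if "feasible n a m y" for y
  proof (cases "cost n c y \<le> cost n c x0")
    case True
    thus ?thesis using zmin[OF inB[OF that]] r that by metis
  next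
    case False
    thus ?thesis using zmin[OF inB[OF x0]] r x0 by force
  qed
  have "OPT n c a m = cost n c z"
    unfolding OPT_def using z min by (intro Least_equality) auto
  thus "\<exists>x. feasible n a m x \<and> cost n c x = OPT n c a m"
    "feasible n a m y \<Longrightarrow> OPT n c a m \<le> cost n c y"
    using z min by auto
qed

end

theory Submission
  imports Defs
begin

text \<open>
  Fix an optimal solution \<open>s\<close>. An update in row \<open>h\<close> costs at most \<open>2 d\<^bsub>m(h)\<^esub>\<close>. It is paid for by the
  increase of the potential \<open>\<Sum>i. c i * s i * ln (1 + K * min (x i / s i) 5)\<close>, where \<open>K\<close> bounds all
  values \<open>k\<close> used by the algorithm. Since \<open>s\<close> satisfies row \<open>h\<close> and \<open>x\<close> violates it, at least half of
  the row is contributed by coordinates with \<open>x i < 2 * s i\<close>, and these push the potential up by a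
  constant multiple of \<open>d\<^bsub>m(h)\<^esub>\<close>. The potential never exceeds \<open>ln (1 + 5 * K)\<close> times the optimum.
\<close>

section \<open>The capped logarithmic potential and elementary inequalities\<close>

definition pot :: "real \<Rightarrow> real \<Rightarrow> real \<Rightarrow> real" where
  "pot K s z = s * ln (1 + K * min (z / s) 5)"

lemma pot_0 [simp]: "pot K s 0 = 0"
  by (simp add: pot_def)

lemma pot_mono:
  assumes "0 \<le> s" "0 \<le> z" "z \<le> z'" "0 \<le> K"
  shows "pot K s z \<le> pot K s z'"
proof -
  have "0 \<le> K * min (z / s) 5"
    using assms by simp
  moreover have "K * min (z / s) 5 \<le> K * min (z' / s) 5"
    using assms by (intro mult_left_mono min.mono divide_right_mono) auto
  ultimately have "ln (1 + K * min (z / s) 5) \<le> ln (1 + K * min (z' / s) 5)"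
    by (subst ln_le_cancel_iff) auto
  thus ?thesis
    unfolding pot_def using assms by (intro mult_left_mono) auto
qed

text \<open>The cap at 5 makes the bound independent of \<open>z\<close>. For \<open>s = 0\<close>
  the factor \<open>s\<close> makes both sides zero, so coordinates absent from the comparison
  solution need no separate treatment.\<close>

lemma pot_le:
  assumes "0 \<le> s" "0 \<le> z" "0 \<le> K"
  shows "pot K s z \<le> s * ln (1 + 5 * K)"
proof -
  have "K * min (z / s) 5 \<le> K * 5"
    using assms by (intro mult_left_mono) auto
  moreover have "0 \<le> K * min (z / s) 5"
    using assms by simp
  ultimately have "ln (1 + K * min (z / s) 5) \<le> ln (1 + 5 * K)"
    by (subst ln_le_cancel_iff) auto
  thus ?thesis
    unfolding pot_def using assms by (intro mult_left_mono) auto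
qed

text \<open>By concavity the logarithm lies above its chord between 1 and 2.\<close>

lemma ln_one_plus_ge:
  fixes u :: real
  assumes "0 \<le> u" "u \<le> 1"
  shows "u * ln 2 \<le> ln (1 + u)"
proof -
  have "concave_on {0<..} (ln :: real \<Rightarrow> real)"
    by (rule ln_concave)
  hence "(1 - u) * ln 1 + u * ln 2 \<le> ln ((1 - u) *\<^sub>R 1 + u *\<^sub>R (2::real))"
    using assms by (intro concave_onD) auto
  also have "(1 - u) *\<^sub>R 1 + u *\<^sub>R (2::real) = 1 + u"
    by simp
  finally show ?thesis
    by simp
qed

text \<open>If \<open>z < 2 * s\<close>, the multiplicative and the additive part of the update
  together raise \<open>1 + K * (z / s)\<close> by a factor of at least \<open>1 + u\<close>, where
  \<open>u = r * min s (1 / \<alpha>) / s\<close>, and \<open>s * ln (1 + u)\<close> is at least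
  \<open>s * u * ln 2\<close>. If \<open>z \<ge> 2 * s\<close>, the term \<open>z / 2\<close> makes
  the left side nonpositive and monotonicity suffices. One bound thus serves all coordinates of a
  row.\<close>

lemma pot_gain:
  assumes "0 \<le> s" "0 \<le> z" "0 < k" "k \<le> K" "1 \<le> K" "0 < \<alpha>" "0 < r" "r \<le> 1"
  shows "ln 2 * r * (min s (1 / \<alpha>) - z / 2)
           \<le> pot K s ((1 + r) * z + 1 / (k * \<alpha>) * r) - pot K s z"
proof (cases "z < 2 * s")
  case False
  have "z \<le> (1 + r) * z + 1 / (k * \<alpha>) * r"
    using assms by (simp add: algebra_simps)
  hence "0 \<le> pot K s ((1 + r) * z + 1 / (k * \<alpha>) * r) - pot K s z"
    using pot_mono assms by simp
  moreover have "ln 2 * r * (min s (1 / \<alpha>) - z / 2) \<le> 0"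
    using False assms by (intro mult_nonneg_nonpos) auto
  ultimately show ?thesis
    by linarith
next
  case True
  hence s: "0 < s"
    using assms by linarith
  define q w w' u where "q = min s (1 / \<alpha>)" and "w = z / s"
    and "w' = min (((1 + r) * z + 1 / (k * \<alpha>) * r) / s) 5" and "u = r * (q / s)"
  have q: "0 < q" "q \<le> s" "q \<le> 1 / \<alpha>"
    using s assms by (auto simp: q_def)
  have w: "0 \<le> w" "w < 2"
    using assms s True by (auto simp: w_def field_simps)
  have u: "0 \<le> u" "u \<le> r" "u \<le> 1"
  proof -
    have "r * (q / s) \<le> r * 1"
      using q s assms by (intro mult_left_mono) auto
    moreover have "0 \<le> r * (q / s)"
      using q s assms by simp
    ultimately show "0 \<le> u" "u \<le> r" "u \<le> 1"
      using q s assms unfolding u_def by linarith+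
  qed
  \<comment> \<open>Passing from \<open>k\<close> to its upper bound \<open>K\<close> lets one
    potential serve rows processed with different values of \<open>k\<close>.\<close>
  have "1 / (k * \<alpha>) \<ge> q / K"
  proof -
    have "q / K \<le> (1 / \<alpha>) / k"
      using q assms by (intro frac_le) auto
    thus ?thesis
      by (simp add: mult.commute)
  qed
  hence "r * (q / K) \<le> r * (1 / (k * \<alpha>))"
    using assms by (intro mult_left_mono) auto
  also have "\<dots> = 1 / (k * \<alpha>) * r"
    by simp
  finally have "r * (q / K) \<le> 1 / (k * \<alpha>) * r" .
  hence "r * (q / K) / s \<le> 1 / (k * \<alpha>) * r / s"
    using s by (intro divide_right_mono) auto
  moreover have "r * (q / K) / s = u / K"
    by (simp add: u_def)
  ultimately have "(1 + r) * w + u / K \<le> ((1 + r) * z + 1 / (k * \<alpha>) * r) / s"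
    by (simp add: w_def add_divide_distrib)
  \<comment> \<open>Origin of the cap: the scaled value is below 2 and at most doubles, and
    \<open>u / K\<close> adds at most 1, so the lower bound for the new value is at most 4 + 1 = 5
    and survives the truncation in \<open>w'\<close>.\<close>
  moreover have "(1 + r) * w \<le> 2 * 2"
    using w assms by (intro mult_mono) auto
  moreover have "u / K \<le> 1"
    using u assms by simp
  ultimately have "(1 + r) * w + u / K \<le> w'"
    by (simp add: w'_def)
  hence "K * ((1 + r) * w + u / K) \<le> K * w'"
    using assms by (intro mult_left_mono) auto
  moreover have "K * ((1 + r) * w + u / K) = K * w + r * (K * w) + u"
    using assms by (simp add: algebra_simps)
  moreover have "u * (K * w) \<le> r * (K * w)"
    using u w assms by (intro mult_right_mono) auto
  ultimately have ge: "(1 + K * w) * (1 + u) \<le> 1 + K * w'"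
    by (simp add: algebra_simps)
  have pos: "0 < 1 + K * w"
    using w assms by (simp add: add_pos_nonneg)
  have "u * ln 2 \<le> ln (1 + u)"
    using u by (intro ln_one_plus_ge)
  also have "\<dots> = ln ((1 + K * w) * (1 + u)) - ln (1 + K * w)"
    using pos u by (simp add: ln_mult)
  also have "\<dots> \<le> ln (1 + K * w') - ln (1 + K * w)"
  proof -
    have "0 < (1 + K * w) * (1 + u)"
      using pos u by (intro mult_pos_pos) auto
    hence "ln ((1 + K * w) * (1 + u)) \<le> ln (1 + K * w')"
      using ge by (subst ln_le_cancel_iff) auto
    thus ?thesis
      by simp
  qed
  finally have "s * (u * ln 2) \<le> s * (ln (1 + K * w') - ln (1 + K * w))"
    using s by (intro mult_left_mono) auto
  moreover have "pot K s z = s * ln (1 + K * w)"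
    using w by (simp add: pot_def w_def)
  moreover have "s * (u * ln 2) = ln 2 * r * q"
    using s by (simp add: u_def)
  moreover have "ln 2 * r * (q - z / 2) \<le> ln 2 * r * q"
    using assms by (intro mult_left_mono) auto
  moreover have "pot K s ((1 + r) * z + 1 / (k * \<alpha>) * r) = s * ln (1 + K * w')"
    by (simp only: pot_def w'_def)
  ultimately show ?thesis
    unfolding q_def right_diff_distrib by linarith
qed

text \<open>Either some capped term already equals 1, or no term is changed by the cap. It absorbs
  the minimum with \<open>1 / \<alpha>\<close> in \<open>pot_gain\<close> once that is scaled by the
  row coefficient.\<close>

lemma sum_min_ge_1:
  fixes f :: "'a \<Rightarrow> real"
  assumes "finite A" "\<And>i. i \<in> A \<Longrightarrow> 0 \<le> f i" "1 \<le> sum f A"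
  shows "1 \<le> (\<Sum>i\<in>A. min (f i) 1)"
proof (cases "\<exists>i\<in>A. 1 \<le> f i")
  case True
  then obtain i where i: "i \<in> A" "1 \<le> f i"
    by blast
  hence "1 = min (f i) 1"
    by simp
  also have "\<dots> \<le> (\<Sum>i\<in>A. min (f i) 1)"
    using assms i by (intro member_le_sum[of i A "\<lambda>i. min (f i) 1"]) auto
  finally show ?thesis .
next
  case False
  hence "(\<Sum>i\<in>A. min (f i) 1) = sum f A"
    by (intro sum.cong) auto
  thus ?thesis
    using assms by simp
qed

section \<open>Row sparsity and the power of two \<open>k\<close>\<close>

lemma card_supp_le_row_sparsity:
  assumes "h \<in> {1..m}"
  shows "card (supp n a h) \<le> row_sparsity n a m"
  unfolding row_sparsity_def using assms by (intro Max_ge) auto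

lemma row_sparsity_mono: "h \<le> m \<Longrightarrow> row_sparsity n a h \<le> row_sparsity n a m"
  unfolding row_sparsity_def by (intro Max_mono) auto

text \<open>For the maximum \<open>M\<close> there is an \<open>e\<close> with
  \<open>2 ^ e \<le> M < 2 ^ (e + 1)\<close>. The upper power is a candidate for the least one and
  is at most \<open>2 * M\<close>.\<close>

lemma kpow_bounds:
  shows "max 2 (row_sparsity n a h) \<le> kpow n a h"
    and "kpow n a h \<le> 2 * max 2 (row_sparsity n a h)"
proof -
  define M where "M = max 2 (row_sparsity n a h)"
  have "\<exists>e. 2 ^ e \<le> M \<and> M < 2 ^ (e + 1)"
    by (rule ex_power_ivl1) (auto simp: M_def)
  then obtain e where e: "2 ^ e \<le> M" "M < 2 ^ (e + 1)"
    by blast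
  let ?Q = "\<lambda>p::nat. (\<exists>e. p = 2 ^ e) \<and> M \<le> p"
  have Q: "?Q (2 ^ (e + 1))"
    using e by (auto intro: exI[of _ "e + 1"])
  have "M \<le> kpow n a h"
    unfolding kpow_def M_def[symmetric] using LeastI[of ?Q, OF Q] by blast
  thus "max 2 (row_sparsity n a h) \<le> kpow n a h"
    by (simp add: M_def)
  have "kpow n a h \<le> 2 ^ (e + 1)"
    unfolding kpow_def M_def[symmetric] by (rule Least_le[of ?Q, OF Q])
  thus "kpow n a h \<le> 2 * max 2 (row_sparsity n a h)"
    using e unfolding M_def by simp
qed

lemma kpow_pos: "0 < real (kpow n a h)"
  using kpow_bounds(1)[of n a h] by simp

section \<open>Effect of one update in a fixed row\<close>

context
  fixes n c a m h
  assumes inst: "covering_instance n c a m" and h: "h \<in> {1..m}"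
begin

lemma finite_supp: "finite (supp n a h)"
  by (simp add: supp_def)

lemma lhs_eq_supp: "lhs n a h x = (\<Sum>i\<in>supp n a h. a i h * x i)"
  unfolding lhs_def
proof (rule sum.mono_neutral_right)
  show "\<forall>i\<in>{1..n} - supp n a h. a i h * x i = 0"
    using inst h by (force simp: covering_instance_def supp_def)
qed (auto simp: supp_def)

lemma lhs_mono:
  assumes "\<And>i. i \<in> {1..n} \<Longrightarrow> x i \<le> y i"
  shows "lhs n a h x \<le> lhs n a h y"
  unfolding lhs_eq_supp using assms by (intro sum_mono mult_left_mono) (auto simp: supp_def)

text \<open>The last identity cancels the cost of a coordinate against its step ratio. It turns
  cost-weighted sums over the row into \<open>dmin\<close> times sums weighted by the row
  coefficients.\<close>

lemma dmin_ratio: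
  assumes "i \<in> supp n a h"
  shows "0 < dmin n c a h / d c a i h" "dmin n c a h / d c a i h \<le> 1"
    "c i * (dmin n c a h / d c a i h) = dmin n c a h * a i h"
proof -
  have pos: "0 < d c a i h" if "i \<in> supp n a h" for i
    using that inst by (auto simp: supp_def d_def covering_instance_def)
  have "dmin n c a h \<in> (\<lambda>i. d c a i h) ` supp n a h"
    unfolding dmin_def using finite_supp assms by (intro Min_in) auto
  hence 1: "0 < dmin n c a h"
    using pos by auto
  have 2: "dmin n c a h \<le> d c a i h"
    unfolding dmin_def using finite_supp assms by (intro Min_le) auto
  show "0 < dmin n c a h / d c a i h" "dmin n c a h / d c a i h \<le> 1"
    using 1 2 pos[OF assms] by auto
  show "c i * (dmin n c a h / d c a i h) = dmin n c a h * a i h"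
    using pos[OF assms] by (auto simp: d_def)
qed

lemma dmin_attained: "\<exists>i\<in>supp n a h. dmin n c a h / d c a i h = 1"
proof -
  have "supp n a h \<noteq> {}"
    using inst h by (simp add: covering_instance_def)
  hence "dmin n c a h \<in> (\<lambda>i. d c a i h) ` supp n a h"
    unfolding dmin_def using finite_supp by (intro Min_in) auto
  then obtain i where i: "i \<in> supp n a h" "dmin n c a h = d c a i h"
    by blast
  thus ?thesis
    using dmin_ratio(1)[OF i(1)] by (intro bexI[of _ i]) auto
qed

lemma dmin_pos: "0 < dmin n c a h"
proof -
  obtain i where i: "i \<in> supp n a h" "dmin n c a h / d c a i h = 1"
    using dmin_attained by blast
  have "0 < c i"
    using i inst by (simp add: supp_def covering_instance_def)
  hence "0 < dmin n c a h * a i h"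
    using dmin_ratio(3)[OF i(1)] i(2) by (simp only: mult_1_right)
  thus ?thesis
    using i by (simp add: supp_def zero_less_mult_iff)
qed

lemma update_ge:
  assumes "\<And>i. i \<in> {1..n} \<Longrightarrow> 0 \<le> x i" "i \<in> {1..n}"
  shows "x i \<le> update n c a h x i"
proof (cases "i \<in> supp n a h")
  case True
  hence "0 < a i h" "0 \<le> x i"
    using assms by (auto simp: supp_def)
  thus ?thesis
    using dmin_ratio(1)[OF True] kpow_pos True
    by (simp add: update_def distrib_right del: times_divide_eq_left times_divide_eq_right)
qed (simp add: update_def)

text \<open>The coordinate attaining \<open>dmin\<close> has ratio 1, so its additive term alone
  contributes \<open>1 / k\<close> to the row, and no other coordinate decreases. This fixed
  progress gives termination.\<close>

lemma lhs_update_ge: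
  assumes x: "\<And>i. i \<in> {1..n} \<Longrightarrow> 0 \<le> x i"
  shows "lhs n a h x + 1 / real (kpow n a h) \<le> lhs n a h (update n c a h x)"
proof -
  let ?y = "update n c a h x"
  obtain i where i: "i \<in> supp n a h" "dmin n c a h / d c a i h = 1"
    using dmin_attained by blast
  have ai: "0 < a i h" "i \<in> {1..n}"
    using i by (auto simp: supp_def)
  have "?y i = 2 * x i + 1 / (real (kpow n a h) * a i h)"
    using i by (simp add: update_def)
  hence "a i h * (?y i - x i) = a i h * x i + 1 / real (kpow n a h)"
    using ai by (simp add: algebra_simps)
  hence "1 / real (kpow n a h) \<le> a i h * (?y i - x i)"
    using ai x[of i] by simp
  also have "\<dots> \<le> (\<Sum>i\<in>supp n a h. a i h * (?y i - x i))"
    using finite_supp i update_ge[of x] x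
    by (intro member_le_sum[of i _ "\<lambda>i. a i h * (?y i - x i)"]) (auto simp: supp_def)
  also have "\<dots> = lhs n a h ?y - lhs n a h x"
    by (simp add: lhs_eq_supp right_diff_distrib sum_subtractf)
  finally show ?thesis
    by simp
qed

text \<open>Only coordinates in the support move. The identity as \<open>f\<close> yields the cost
  increase, \<open>pot\<close> the potential increase.\<close>

lemma sum_update_diff:
  "(\<Sum>i=1..n. c i * (f i (update n c a h x i) - f i (x i)))
     = (\<Sum>i\<in>supp n a h. c i * (f i (update n c a h x i) - f i (x i)))"
  for f :: "nat \<Rightarrow> real \<Rightarrow> real"
  by (rule sum.mono_neutral_right) (auto simp: supp_def update_def)

text \<open>Coordinate \<open>i\<close> pays \<open>dmin\<close> times
  \<open>a i h * x i + 1 / k\<close>. The first terms sum to less than 1 because the row is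
  violated, the second to at most 1 because \<open>k\<close> bounds the support size.\<close>

lemma cost_update_le:
  assumes "\<And>i. i \<in> {1..n} \<Longrightarrow> 0 \<le> x i" "lhs n a h x < 1"
  shows "cost n c (update n c a h x) - cost n c x \<le> 2 * dmin n c a h"
proof -
  let ?T = "supp n a h" and ?k = "real (kpow n a h)" and ?D = "dmin n c a h"
  have "cost n c (update n c a h x) - cost n c x
      = (\<Sum>i\<in>?T. c i * (update n c a h x i - x i))"
    using sum_update_diff[of "\<lambda>_ z. z"]
    by (simp add: cost_def right_diff_distrib sum_subtractf)
  also have "\<dots> = (\<Sum>i\<in>?T. ?D * (a i h * x i + 1 / ?k))"
  proof (rule sum.cong)
    fix i assume i: "i \<in> ?T"
    have "(1 + r) * z + w * r - z = r * (z + w)" for r z w :: real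
      by (simp add: algebra_simps)
    hence "c i * (update n c a h x i - x i)
        = (c i * (?D / d c a i h)) * (x i + 1 / (?k * a i h))"
      using i by (simp only: update_def if_True mult.assoc)
    also have "\<dots> = ?D * a i h * (x i + 1 / (?k * a i h))"
      by (simp only: dmin_ratio(3)[OF i])
    also have "\<dots> = ?D * (a i h * x i + 1 / ?k)"
      using i by (simp add: supp_def algebra_simps)
    finally show "c i * (update n c a h x i - x i) = ?D * (a i h * x i + 1 / ?k)" .
  qed simp
  also have "\<dots> = ?D * (lhs n a h x + real (card ?T) / ?k)"
    by (simp add: lhs_eq_supp sum_distrib_left[symmetric] sum.distrib)
  also have "\<dots> \<le> ?D * 2"
  proof -
    have "card ?T \<le> kpow n a h"
      using card_supp_le_row_sparsity[of h h n a] kpow_bounds(1)[of n a h] h by simp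
    hence "real (card ?T) / ?k \<le> 1"
      using kpow_pos by simp
    thus ?thesis
      using dmin_pos assms by (intro mult_left_mono) auto
  qed
  finally show ?thesis
    by simp
qed

text \<open>Weighting \<open>pot_gain\<close> by costs gives \<open>ln 2 * dmin\<close> times a sum
  of capped contributions of \<open>s\<close> minus half those of \<open>x\<close>. The former total
  at least 1, the latter less than 1/2.\<close>

lemma pot_update_ge:
  assumes x: "\<And>i. i \<in> {1..n} \<Longrightarrow> 0 \<le> x i" "lhs n a h x < 1"
    and s: "\<And>i. i \<in> {1..n} \<Longrightarrow> 0 \<le> s i" "1 \<le> lhs n a h s"
    and K: "real (kpow n a h) \<le> K"
  shows "ln 2 / 2 * dmin n c a h
    \<le> (\<Sum>i=1..n. c i * (pot K (s i) (update n c a h x i) - pot K (s i) (x i)))"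
proof -
  let ?T = "supp n a h" and ?k = "real (kpow n a h)" and ?D = "dmin n c a h"
  have K1: "1 \<le> K"
    using K kpow_bounds(1)[of n a h] by simp
  have "1 \<le> (\<Sum>i\<in>?T. min (a i h * s i) 1)"
    using s finite_supp by (intro sum_min_ge_1) (auto simp: supp_def lhs_eq_supp)
  moreover have "(\<Sum>i\<in>?T. a i h * x i / 2) < 1 / 2"
    using x by (simp add: lhs_eq_supp sum_divide_distrib[symmetric])
  ultimately have "1 / 2 \<le> (\<Sum>i\<in>?T. min (a i h * s i) 1 - a i h * x i / 2)"
    by (simp add: sum_subtractf)
  hence "ln 2 * ?D * (1 / 2) \<le> ln 2 * ?D * (\<Sum>i\<in>?T. min (a i h * s i) 1 - a i h * x i / 2)"
    using dmin_pos by (intro mult_left_mono) auto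
  also have "\<dots> = (\<Sum>i\<in>?T. ln 2 * ?D * (min (a i h * s i) 1 - a i h * x i / 2))"
    by (simp add: sum_distrib_left)
  also have "\<dots> \<le> (\<Sum>i\<in>?T. c i * (pot K (s i) (update n c a h x i) - pot K (s i) (x i)))"
  proof (rule sum_mono)
    fix i assume i: "i \<in> ?T"
    let ?r = "?D / d c a i h"
    have i': "i \<in> {1..n}" "0 < a i h" "0 < c i"
      using i inst by (auto simp: supp_def covering_instance_def)
    \<comment> \<open>Pulling out the coefficient matches the minimum in \<open>pot_gain\<close>
      with \<alpha> equal to \<open>a i h\<close>.\<close>
    have "min (a i h * s i) 1 = a i h * min (s i) (1 / a i h)"
      using i' by (simp add: min_def field_simps)
    hence "ln 2 * ?D * (min (a i h * s i) 1 - a i h * x i / 2)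
        = ln 2 * (?D * a i h) * (min (s i) (1 / a i h) - x i / 2)"
      by (simp add: algebra_simps)
    also have "\<dots> = c i * (ln 2 * ?r * (min (s i) (1 / a i h) - x i / 2))"
      by (simp only: dmin_ratio(3)[OF i, symmetric] mult.assoc mult.left_commute)
    also have "\<dots> \<le> c i * (pot K (s i) (update n c a h x i) - pot K (s i) (x i))"
    proof (rule mult_left_mono)
      show "ln 2 * ?r * (min (s i) (1 / a i h) - x i / 2)
          \<le> pot K (s i) (update n c a h x i) - pot K (s i) (x i)"
        using pot_gain[of "s i" "x i" ?k K "a i h" ?r] i i' x s K K1 kpow_pos dmin_ratio[OF i]
        by (simp add: update_def)
    qed (use i' in simp)
    finally show "ln 2 * ?D * (min (a i h * s i) 1 - a i h * x i / 2)
        \<le> c i * (pot K (s i) (update n c a h x i) - pot K (s i) (x i))" .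
  qed
  also have "\<dots> = (\<Sum>i=1..n. c i * (pot K (s i) (update n c a h x i) - pot K (s i) (x i)))"
    by (rule sum_update_diff[of "\<lambda>i. pot K (s i)", symmetric])
  finally show ?thesis
    by simp
qed

end

section \<open>The invariant of a run and termination of the loops\<close>

text \<open>The comparison with the last vector keeps the list sorted when a larger vector is
  appended. The factor \<open>4 / ln 2\<close> is the quotient of the cost bound
  \<open>2 * dmin\<close> and the potential gain \<open>ln 2 / 2 * dmin\<close> of an
  update.\<close>

definition run_inv ::
  "nat \<Rightarrow> (nat \<Rightarrow> real) \<Rightarrow> (nat \<Rightarrow> nat \<Rightarrow> real) \<Rightarrow> real \<Rightarrow> (nat \<Rightarrow> real) \<Rightarrow> nat \<Rightarrow> (nat \<Rightarrow> real) list \<Rightarrow> bool"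
where
  "run_inv n c a K s h xs \<longleftrightarrow>
     xs \<noteq> [] \<and>
     sorted_wrt (\<lambda>y z. \<forall>i\<in>{1..n}. y i \<le> z i) xs \<and>
     (\<forall>y\<in>set xs. \<forall>i\<in>{1..n}. y i \<le> last xs i) \<and>
     feasible n a h (last xs) \<and>
     cost n c (last xs) \<le> 4 / ln 2 * (\<Sum>i=1..n. c i * pot K (s i) (last xs i))"

text \<open>Growing coordinates keep the earlier rows satisfied, as coefficients are nonnegative.
  The cost clause follows by adding the bounds for a single update.\<close>

lemma run_inv_update:
  assumes inst: "covering_instance n c a m" and h: "Suc h \<le> m"
    and s: "feasible n a m s" and K: "real (kpow n a (Suc h)) \<le> K"
    and inv: "run_inv n c a K s h xs" and lt: "lhs n a (Suc h) (last xs) < 1"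
  shows "run_inv n c a K s h (xs @ [update n c a (Suc h) (last xs)])"
proof -
  define x y where "x = last xs" and "y = update n c a (Suc h) x"
  have h': "Suc h \<in> {1..m}"
    using h by simp
  have x0: "0 \<le> x i" if "i \<in> {1..n}" for i
    using inv that by (auto simp: run_inv_def feasible_def x_def)
  have xy: "x i \<le> y i" if "i \<in> {1..n}" for i
    unfolding y_def by (rule update_ge[OF inst h' x0 that])
  have s': "\<And>i. i \<in> {1..n} \<Longrightarrow> 0 \<le> s i" "1 \<le> lhs n a (Suc h) s"
    using s h' by (auto simp: feasible_def)
  have "\<forall>z\<in>set xs. \<forall>i\<in>{1..n}. z i \<le> y i"
    using inv xy unfolding run_inv_def x_def by (meson order_trans)
  moreover have "feasible n a h y"
    unfolding feasible_def
  proof (intro conjI ballI)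
    fix i assume "i \<in> {1..n}"
    thus "0 \<le> y i"
      using x0 xy order_trans by blast
  next
    fix j assume j: "j \<in> {1..h}"
    hence "j \<in> {1..m}"
      using h by simp
    hence "lhs n a j x \<le> lhs n a j y"
      using xy by (intro lhs_mono[OF inst]) auto
    moreover have "1 \<le> lhs n a j x"
      using inv j by (auto simp: run_inv_def feasible_def x_def)
    ultimately show "1 \<le> lhs n a j y"
      by simp
  qed
  moreover have "cost n c y \<le> 4 / ln 2 * (\<Sum>i=1..n. c i * pot K (s i) (y i))"
  proof -
    have "cost n c y - cost n c x \<le> 2 * dmin n c a (Suc h)"
      unfolding y_def using lt x0 by (intro cost_update_le[OF inst h']) (auto simp: x_def)
    also have "\<dots> = 4 / ln 2 * (ln 2 / 2 * dmin n c a (Suc h))"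
      by simp
    also have "\<dots> \<le> 4 / ln 2 * (\<Sum>i=1..n. c i * (pot K (s i) (y i) - pot K (s i) (x i)))"
      unfolding y_def using lt x0 s' K
      by (intro mult_left_mono pot_update_ge[OF inst h']) (auto simp: x_def)
    finally have "cost n c y - cost n c x
        \<le> 4 / ln 2 * (\<Sum>i=1..n. c i * (pot K (s i) (y i) - pot K (s i) (x i)))" .
    moreover have "cost n c x \<le> 4 / ln 2 * (\<Sum>i=1..n. c i * pot K (s i) (x i))"
      using inv by (simp add: run_inv_def x_def)
    ultimately show ?thesis
      by (simp add: right_diff_distrib sum_subtractf)
  qed
  ultimately show ?thesis
    using inv unfolding x_def[symmetric] y_def[symmetric]
    by (auto simp: run_inv_def sorted_wrt_append)
qed

text \<open>Induction on rows. While row \<open>Suc h\<close> is processed, the invariant for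
  \<open>h\<close> is maintained; the exit condition then supplies the new row.\<close>

lemma algI_run_inv:
  assumes inst: "covering_instance n c a m" and s: "feasible n a m s"
    and K: "\<And>h. h \<le> m \<Longrightarrow> real (kpow n a h) \<le> K" and "h \<le> m"
  shows "\<exists>xs. algI n c a h = Some xs \<and> run_inv n c a K s h xs"
  using \<open>h \<le> m\<close>
proof (induction h)
  case 0
  show ?case
    by (simp add: run_inv_def feasible_def cost_def)
next
  case (Suc h)
  then obtain xs where xs: "algI n c a h = Some xs" "run_inv n c a K s h xs"
    by auto
  let ?b = "\<lambda>xs. lhs n a (Suc h) (last xs) < 1"
  let ?f = "\<lambda>xs. xs @ [update n c a (Suc h) (last xs)]"
  let ?k = "real (kpow n a (Suc h))"
  \<comment> \<open>The row deficit in units of \<open>1 / k\<close>, rounded up: each update gains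
    at least one unit.\<close>
  let ?\<mu> = "\<lambda>xs. nat \<lceil>?k * (1 - lhs n a (Suc h) (last xs))\<rceil>"
  have h': "Suc h \<in> {1..m}"
    using Suc.prems by simp
  have step: "run_inv n c a K s h (?f ys) \<and> ?\<mu> (?f ys) < ?\<mu> ys"
    if ys: "run_inv n c a K s h ys" "?b ys" for ys
  proof
    show "run_inv n c a K s h (?f ys)"
      using run_inv_update[OF inst Suc.prems s K[OF Suc.prems] ys] .
    let ?l = "lhs n a (Suc h) (last ys)" and ?l' = "lhs n a (Suc h) (last (?f ys))"
    have "?l + 1 / ?k \<le> ?l'"
      using lhs_update_ge[OF inst h', of "last ys"] ys by (auto simp: run_inv_def feasible_def)
    hence "?k * (?l + 1 / ?k) \<le> ?k * ?l'"
      by (intro mult_left_mono) auto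
    hence "?k * (1 - ?l') \<le> ?k * (1 - ?l) - 1"
      using kpow_pos[of n a "Suc h"] by (simp add: algebra_simps)
    hence "\<lceil>?k * (1 - ?l')\<rceil> \<le> \<lceil>?k * (1 - ?l)\<rceil> - 1"
      by linarith
    \<comment> \<open>Positivity before the update makes the decrease strict after conversion by
      \<open>nat\<close>, which sends negative values to 0.\<close>
    moreover have "0 < \<lceil>?k * (1 - ?l)\<rceil>"
      using ys kpow_pos[of n a "Suc h"] by simp
    ultimately show "?\<mu> (?f ys) < ?\<mu> ys"
      by linarith
  qed
  obtain zs where zs: "while_option ?b ?f xs = Some zs"
    using measure_while_option_Some[of "run_inv n c a K s h" ?b ?f ?\<mu>, OF step xs(2)] by blast
  have inv: "run_inv n c a K s h zs"
    using while_option_rule[of "run_inv n c a K s h" ?b ?f, OF _ zs xs(2)] step by blast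
  have "\<not> ?b zs"
    using while_option_stop[OF zs] .
  hence "run_inv n c a K s (Suc h) zs"
    using inv by (auto simp: run_inv_def feasible_def le_Suc_eq)
  thus ?case
    using xs zs by simp
qed

section \<open>The competitive ratio\<close>

theorem theorem1:
  shows "\<exists>C::real. \<forall>(n::nat) (c :: nat \<Rightarrow> real) (a :: nat \<Rightarrow> nat \<Rightarrow> real) (m::nat).
    covering_instance n c a m \<longrightarrow>
    (\<exists>xs x. algI n c a m = Some xs \<and> x = last xs \<and>
       sorted_wrt (\<lambda>y z. \<forall>i\<in>{1..n}. y i \<le> z i) xs \<and>
       (\<forall>j\<in>{1..m}. (\<Sum>i=1..n. a i j * x i) \<ge> 1) \<and>
       (\<forall>i\<in>{1..n}. x i \<ge> 0) \<and>
       (\<Sum>i=1..n. c i * x i) \<le> C * log 2 (real (max 2 (row_sparsity n a m))) * OPT n c a m)"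
\<comment> \<open>The constant is 4 * 5: the 4 comes from the invariant, the 5 from bounding
  \<open>ln (1 + 5 * K)\<close> by \<open>5 * ln M\<close>.\<close>
proof (intro exI[of _ 20] allI impI)
  fix n c a m
  assume inst: "covering_instance n c a m"
  obtain s where s: "feasible n a m s" "cost n c s = OPT n c a m"
    using OPT_attained(1)[OF inst] by blast
  \<comment> \<open>Rounding up to a power of two at most doubles, so \<open>K\<close> dominates
    every \<open>k\<close> used up to row \<open>m\<close>.\<close>
  define M K where "M = real (max 2 (row_sparsity n a m))" and "K = 2 * M"
  have M: "2 \<le> M"
    by (simp add: M_def)
  have K: "real (kpow n a h) \<le> K" if "h \<le> m" for h
  proof -
    have "kpow n a h \<le> 2 * max 2 (row_sparsity n a m)"
      using kpow_bounds(2)[of n a h] row_sparsity_mono[OF that, of n a] by linarith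
    thus ?thesis
      unfolding K_def M_def by linarith
  qed
  obtain xs where xs: "algI n c a m = Some xs" "run_inv n c a K s m xs"
    using algI_run_inv[OF inst s(1) K] by blast
  let ?x = "last xs"
  have feas: "feasible n a m ?x"
    using xs by (simp add: run_inv_def)
  have cpos: "0 < c i" if "i \<in> {1..n}" for i
    using inst that by (simp add: covering_instance_def)
  have "cost n c ?x \<le> 4 / ln 2 * (\<Sum>i=1..n. c i * pot K (s i) (?x i))"
    using xs by (simp add: run_inv_def)
  also have "\<dots> \<le> 4 / ln 2 * (\<Sum>i=1..n. c i * (s i * ln (1 + 5 * K)))"
    using feas s(1) cpos M
    by (intro mult_left_mono sum_mono pot_le) (auto simp: feasible_def K_def less_imp_le)
  also have "\<dots> = 4 / ln 2 * ln (1 + 5 * K) * OPT n c a m"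
    by (simp add: s(2)[symmetric] cost_def sum_distrib_left sum_divide_distrib ac_simps)
  also have "\<dots> \<le> 4 / ln 2 * (5 * ln M) * OPT n c a m"
  proof -
    \<comment> \<open>With \<open>K = 2 * M\<close> and \<open>M \<ge> 2\<close>, this gives
      \<open>1 + 10 * M \<le> 16 * M \<le> M ^ 5\<close>.\<close>
    have "2 ^ 4 * M \<le> M ^ 4 * M"
      using M by (intro mult_right_mono power_mono) auto
    also have "M ^ 4 * M = M ^ 5"
      by (simp add: eval_nat_numeral)
    finally have "1 + 5 * K \<le> M ^ 5"
      using M by (simp add: K_def)
    hence "ln (1 + 5 * K) \<le> ln (M ^ 5)"
      using M by (subst ln_le_cancel_iff) (auto simp: K_def)
    also have "\<dots> = 5 * ln M"
      using M by (simp add: ln_realpow)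
    finally have "ln (1 + 5 * K) \<le> 5 * ln M" .
    moreover have "0 \<le> OPT n c a m"
      unfolding s(2)[symmetric] cost_def using s(1) cpos
      by (intro sum_nonneg mult_nonneg_nonneg) (auto simp: feasible_def less_imp_le)
    ultimately show ?thesis
      by (intro mult_right_mono mult_left_mono) auto
  qed
  also have "\<dots> = 20 * log 2 M * OPT n c a m"
    by (simp add: log_def)
  finally have "cost n c ?x \<le> 20 * log 2 M * OPT n c a m" .
  thus "\<exists>xs x. algI n c a m = Some xs \<and> x = last xs \<and>
       sorted_wrt (\<lambda>y z. \<forall>i\<in>{1..n}. y i \<le> z i) xs \<and>
       (\<forall>j\<in>{1..m}. (\<Sum>i=1..n. a i j * x i) \<ge> 1) \<and>
       (\<forall>i\<in>{1..n}. x i \<ge> 0) \<and>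
       (\<Sum>i=1..n. c i * x i) \<le> 20 * log 2 (real (max 2 (row_sparsity n a m))) * OPT n c a m"
    using xs feas unfolding M_def by (auto simp: run_inv_def feasible_def cost_def lhs_def)
qed

end
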